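(* Let $\mathbb{F}$ be a field and let $\mathbf{L}=\mathbf{V}\rtimes\mathbb{F}e_0$ be an indecomposable almost Abelian Lie algebra over $\mathbb{F}$ that is not isomorphic to either $\mathbf{ax+b}_{\mathbb{F}}$ or $\mathbf{H}_{\mathbb{F}}$. Then its Lie orthogonal operators are $$\mathrm{LO}(\mathbf{L})=\left\{\begin{pmatrix}\frac1\alpha\mathbf{1}+Z&\gamma\\ 0&\alpha\end{pmatrix}\;\middle|\;\alpha\in\mathbb{F}^*,\ \gamma\in\mathbf{V},\ Z\in\mathrm{Hom}(\mathbf{V},\ker\mathrm{ad}_{e_0})\right\}.$$
   Context: An almost Abelian Lie algebra over a field $\mathbb{F}$ (of arbitrary, possibly infinite, dimension) is a non-Abelian Lie algebra that contains a codimension 1 Abelian subalgebra; it then has a codimension 1 Abelian ideal. Writing $\mathbf{L}=\mathbf{V}\rtimes\mathbb{F}e_0$ means: $\mathbf{V}\subset\mathbf{L}$ is a codimension 1 Abelian ideal, $e_0\in\mathbf{L}\setminus\mathbf{V}$, and $\mathbf{L}=\mathbf{V}\oplus\mathbb{F}e_0$ as vector spaces. The operator $\mathrm{ad}_{e_0}\in\mathrm{End}_{\mathbb{F}}(\mathbf{V})$ is $v\mapsto[e_0,v]$ (so $\ker\mathrm{ad}_{e_0}\subset\mathbf{V}$); it is nonzero. A Lie algebra is decomposable if it is the direct sum of two commuting nonzero Lie subalgebras; otherwise it is indecomposable. $\mathbf{ax+b}_{\mathbb{F}}$ is the 2-dimensional Lie algebra with basis $e_0,e_1$ and $[e_0,e_1]=e_1$;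 $\mathbf{H}_{\mathbb{F}}$ is the 3-dimensional Lie algebra with basis $e_0,e_1,e_2$ and $[e_0,e_2]=e_1$, $[e_0,e_1]=[e_1,e_2]=0$. A linear operator $T\in\mathrm{End}_{\mathbb{F}}(\mathbf{L})$ is Lie orthogonal if $[TX,TY]=[X,Y]$ for all $X,Y\in\mathbf{L}$; $\mathrm{LO}(\mathbf{L})$ is the set of all Lie orthogonal operators. The matrix $\begin{pmatrix}\Delta&\gamma\\ 0&\alpha\end{pmatrix}$ denotes the linear map sending $v+te_0$ to $(\Delta v+t\gamma)+\alpha te_0$ for $v\in\mathbf{V}$, $t\in\mathbb{F}$. $\mathrm{Hom}(\mathbf{V},\ker\mathrm{ad}_{e_0})$ is the space of linear maps $\mathbf{V}\to\ker\mathrm{ad}_{e_0}$, $\mathbf{1}$ is the identity operator on $\mathbf{V}$, and $\mathbb{F}^*=\mathbb{F}\setminus\{0\}$. *)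

theory Defs
  imports Complex_Main "HOL-Library.Product_Plus" "HOL-Library.FuncSet"
begin

locale lie_algebra = vector_space scale
  for scale :: "'a::field \<Rightarrow> 'b::ab_group_add \<Rightarrow> 'b" +
  fixes bracket :: "'b \<Rightarrow> 'b \<Rightarrow> 'b"
  assumes bracket_add_left: "bracket (x + y) z = bracket x z + bracket y z"
    and bracket_add_right: "bracket x (y + z) = bracket x y + bracket x z"
    and bracket_scale_left: "bracket (scale c x) y = scale c (bracket x y)"
    and bracket_scale_right: "bracket x (scale c y) = scale c (bracket x y)"
    and bracket_self: "bracket x x = 0"
    and jacobi: "bracket x (bracket y z) + bracket y (bracket z x) + bracket z (bracket x y) = 0"
begin

definition lie_subalgebra :: "'b set \<Rightarrow> bool" where
  "lie_subalgebra A \<longleftrightarrow> subspace A \<and> (\<forall>x\<in>A. \<forall>y\<in>A. bracket x y \<in> A)"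

definition lie_ideal :: "'b set \<Rightarrow> bool" where
  "lie_ideal A \<longleftrightarrow> subspace A \<and> (\<forall>x. \<forall>y\<in>A. bracket x y \<in> A)"

definition commuting :: "'b set \<Rightarrow> 'b set \<Rightarrow> bool" where
  "commuting A B \<longleftrightarrow> (\<forall>x\<in>A. \<forall>y\<in>B. bracket x y = 0)"

definition abelian :: "'b set \<Rightarrow> bool" where
  "abelian A \<longleftrightarrow> commuting A A"

definition is_direct_sum :: "'b set \<Rightarrow> 'b set \<Rightarrow> bool" where
  "is_direct_sum A B \<longleftrightarrow> A \<inter> B = {0} \<and> {a + b | a b. a \<in> A \<and> b \<in> B} = UNIV"

text \<open>The whole space may be infinite-dimensional, so codimension is expressed by the
  dimension of a complement.\<close>

definition codim_one :: "'b set \<Rightarrow> bool" where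
  "codim_one A \<longleftrightarrow> subspace A \<and> (\<exists>W. subspace W \<and> dim W = 1 \<and> is_direct_sum A W)"

definition almost_abelian :: bool where
  "almost_abelian \<longleftrightarrow>
     \<not> abelian UNIV \<and> (\<exists>A. lie_subalgebra A \<and> codim_one A \<and> abelian A)"

definition semidirect_decomp :: "'b set \<Rightarrow> 'b \<Rightarrow> bool" where
  "semidirect_decomp V e0 \<longleftrightarrow>
     lie_ideal V \<and> codim_one V \<and> abelian V \<and> e0 \<notin> V \<and> is_direct_sum V (span {e0})"

definition decomposable :: bool where
  "decomposable \<longleftrightarrow>
     (\<exists>A B. lie_subalgebra A \<and> lie_subalgebra B \<and> A \<noteq> {0} \<and> B \<noteq> {0} \<and>
            commuting A B \<and> is_direct_sum A B)"

definition ker_ad :: "'b set \<Rightarrow> 'b \<Rightarrow> 'b set" where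
  "ker_ad V e0 = {v \<in> V. bracket e0 v = 0}"

definition LO :: "('b \<Rightarrow> 'b) set" where
  "LO = {T. Vector_Spaces.linear scale scale T \<and>
            (\<forall>x y. bracket (T x) (T y) = bracket x y)}"

text \<open>Linear maps between subspaces are represented by functions on the whole space whose
  values outside \<open>V\<close> are irrelevant.\<close>

definition Hom :: "'b set \<Rightarrow> 'b set \<Rightarrow> ('b \<Rightarrow> 'b) set" where
  "Hom V W = {Z \<in> V \<rightarrow> W. (\<forall>u\<in>V. \<forall>v\<in>V. Z (u + v) = Z u + Z v) \<and>
                           (\<forall>c. \<forall>v\<in>V. Z (scale c v) = scale c (Z v))}"

text \<open>The operator with block matrix \<open>(D, g; 0, a)\<close>; see \<open>block_op_apply\<close> below.\<close>

definition block_op :: "'b set \<Rightarrow> 'b \<Rightarrow> ('b \<Rightarrow> 'b) \<Rightarrow> 'b \<Rightarrow> 'a \<Rightarrow> 'b \<Rightarrow> 'b" where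
  "block_op V e0 D g a x =
     (THE y. \<exists>v\<in>V. \<exists>t. x = v + scale t e0 \<and> y = (D v + scale t g) + scale (a * t) e0)"

lemma block_op_apply:
  assumes "semidirect_decomp V e0" "v \<in> V"
  shows "block_op V e0 D g a (v + scale t e0) = (D v + scale t g) + scale (a * t) e0"
  unfolding block_op_def
proof (rule the_equality)
  show "\<exists>v'\<in>V. \<exists>t'. v + scale t e0 = v' + scale t' e0 \<and>
          (D v + scale t g) + scale (a * t) e0 = (D v' + scale t' g) + scale (a * t') e0"
    using assms(2) by blast
next
  fix y
  assume "\<exists>v'\<in>V. \<exists>t'. v + scale t e0 = v' + scale t' e0 \<and>
            y = (D v' + scale t' g) + scale (a * t') e0"
  then obtain v' t' where v': "v' \<in> V" and eq: "v + scale t e0 = v' + scale t' e0"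
    and y: "y = (D v' + scale t' g) + scale (a * t') e0" by blast
  have V: "subspace V" and int: "V \<inter> span {e0} = {0}" and e0: "e0 \<notin> V"
    using assms(1) by (auto simp: semidirect_decomp_def lie_ideal_def is_direct_sum_def)
  have d: "v - v' = scale (t' - t) e0"
    using eq by (simp add: scale_left_diff_distrib algebra_simps)
  have "v - v' \<in> V \<inter> span {e0}"
    using subspace_diff[OF V assms(2) v'] by (simp add: d span_base span_scale)
  then have z: "v - v' = 0" using int by blast
  moreover have "e0 \<noteq> 0" using e0 subspace_0[OF V] by metis
  ultimately have "t' = t" using d by simp
  with z y show "y = (D v + scale t g) + scale (a * t) e0" by simp
qed

end

definition lie_isomorphic ::
  "('a::field \<Rightarrow> 'b::ab_group_add \<Rightarrow> 'b) \<Rightarrow> ('b \<Rightarrow> 'b \<Rightarrow> 'b) \<Rightarrow>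
   ('a \<Rightarrow> 'c::ab_group_add \<Rightarrow> 'c) \<Rightarrow> ('c \<Rightarrow> 'c \<Rightarrow> 'c) \<Rightarrow> bool" where
  "lie_isomorphic s1 br1 s2 br2 \<longleftrightarrow>
     (\<exists>f. Vector_Spaces.linear s1 s2 f \<and> bij f \<and> (\<forall>x y. f (br1 x y) = br2 (f x) (f y)))"

text \<open>The algebra ax+b in coordinates with respect to the basis \<open>e0 = (1,0)\<close>, \<open>e1 = (0,1)\<close>.\<close>

definition axb_scale :: "'a::field \<Rightarrow> 'a \<times> 'a \<Rightarrow> 'a \<times> 'a" where
  "axb_scale c = (\<lambda>(x0, x1). (c * x0, c * x1))"

definition axb_bracket :: "'a::field \<times> 'a \<Rightarrow> 'a \<times> 'a \<Rightarrow> 'a \<times> 'a" where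
  "axb_bracket = (\<lambda>(x0, x1) (y0, y1). (0, x0 * y1 - x1 * y0))"

text \<open>The Heisenberg algebra in coordinates with respect to the basis
  \<open>e0 = (1,0,0)\<close>, \<open>e1 = (0,1,0)\<close>, \<open>e2 = (0,0,1)\<close>.\<close>

definition heis_scale :: "'a::field \<Rightarrow> 'a \<times> 'a \<times> 'a \<Rightarrow> 'a \<times> 'a \<times> 'a" where
  "heis_scale c = (\<lambda>(x0, x1, x2). (c * x0, c * x1, c * x2))"

definition heis_bracket :: "'a::field \<times> 'a \<times> 'a \<Rightarrow> 'a \<times> 'a \<times> 'a \<Rightarrow> 'a \<times> 'a \<times> 'a" where
  "heis_bracket = (\<lambda>(x0, x1, x2) (y0, y1, y2). (0, x0 * y2 - x2 * y0, 0))"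

lemma lie_algebra_axb: "lie_algebra axb_scale axb_bracket"
  by unfold_locales
    (auto simp: axb_scale_def axb_bracket_def algebra_simps zero_prod_def)

lemma axb_bracket_basis: "axb_bracket (1, 0) (0, 1) = (0, 1)"
  by (simp add: axb_bracket_def)

lemma lie_algebra_heis: "lie_algebra heis_scale heis_bracket"
  by unfold_locales
    (auto simp: heis_scale_def heis_bracket_def algebra_simps zero_prod_def)

lemma heis_bracket_basis:
  "heis_bracket (1, 0, 0) (0, 0, 1) = (0, 1, 0)"
  "heis_bracket (1, 0, 0) (0, 1, 0) = 0"
  "heis_bracket (0, 1, 0) (0, 0, 1) = 0"
  by (simp_all add: heis_bracket_def zero_prod_def)

end

theory Submission
  imports Defs
begin

text \<open>
  Let \<open>coef\<close> be the linear form on \<open>L\<close> with kernel \<open>V\<close> and \<open>coef e0 = 1\<close>. Since \<open>V\<close> is Abelian, the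
  whole bracket is \<open>[x, y] = coef x [e0, y] - coef y [e0, x]\<close>, so it is known once \<open>coef\<close> and
  \<open>ad e0\<close> are. A Lie orthogonal \<open>T\<close> that maps \<open>V\<close> into itself is then governed by the single
  condition \<open>coef (T e0) [e0, T v] = [e0, v]\<close> on \<open>V\<close>. As \<open>ad e0\<close> is not zero, \<open>\<alpha> = coef (T e0)\<close> is
  invertible, and \<open>T - 1 / \<alpha>\<close> maps \<open>V\<close> into the kernel of \<open>ad e0\<close>; conversely, every such block
  operator satisfies the condition.

  The point is therefore that \<open>T\<close> preserves \<open>V\<close>. If \<open>coef (T u) \<noteq> 0\<close> for some \<open>u\<close> in \<open>V\<close>, then
  \<open>[T u, T v] = 0\<close> makes every \<open>[e0, T v]\<close> a multiple of \<open>[e0, T u]\<close>, and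
  \<open>[T e0, T v] = [e0, v]\<close> turns this into \<open>[e0, v] = coef (T v) y\<close> with a fixed \<open>y\<close>: the operator
  \<open>ad e0\<close> has rank one on \<open>V\<close> (\<open>ad_rank_one_if_not_preserving\<close>). All brackets are then multiples of
  \<open>y\<close>. In an indecomposable algebra a central vector outside the derived algebra would span a
  direct summand, so the kernel of \<open>v \<mapsto> coef (T v)\<close> on \<open>V\<close>, which is central, lies in the line of \<open>y\<close>
  (\<open>central_in_derived\<close>). This leaves dimension two, if \<open>coef (T y) \<noteq> 0\<close>, and dimension three
  otherwise; these are the two excluded algebras (\<open>ad_rank_one_cases\<close>).
\<close>

section \<open>Isomorphisms\<close>

text \<open>The models come with explicit bases, so it is easier to give the map out of the model.\<close>

lemma lie_isomorphic_if_from_model: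
  assumes lin: "Vector_Spaces.linear s2 s1 g" and bij: "bij g"
    and hom: "\<And>x y. g (br2 x y) = br1 (g x) (g y)"
  shows "lie_isomorphic s1 br1 s2 br2"
proof -
  have gf [simp]: "g (inv g z) = z" and fg [simp]: "inv g (g x) = x" for x z
    using bij by (simp_all add: bij_is_surj surj_f_inv_f bij_is_inj)
  have g: "g (x + y) = g x + g y" "g (s2 c x) = s1 c (g x)" for x y c
    using lin by (simp_all add: Vector_Spaces.linear_iff)
  have "inv g (x + y) = inv g x + inv g y" for x y
    by (metis gf fg g(1))
  moreover have "inv g (s1 c x) = s2 c (inv g x)" for c x
    by (metis gf fg g(2))
  ultimately have "Vector_Spaces.linear s1 s2 (inv g)"
    using lin by (simp add: Vector_Spaces.linear_iff)
  moreover have "inv g (br1 x y) = br2 (inv g x) (inv g y)" for x y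
    by (metis gf fg hom)
  ultimately show ?thesis
    unfolding lie_isomorphic_def using bij_imp_bij_inv[OF bij] by blast
qed

context lie_algebra
begin

section \<open>Brackets and central elements\<close>

lemma bracket_diff_right: "bracket x (y - z) = bracket x y - bracket x z"
  using bracket_add_right[of x "y - z" z] by simp

lemma bracket_anticomm: "bracket x y = - bracket y x"
proof -
  have "bracket x y + bracket y x = bracket (x + y) (x + y)"
    unfolding bracket_add_left bracket_add_right by (simp add: bracket_self)
  also have "\<dots> = 0" by (rule bracket_self)
  finally show ?thesis by (simp add: eq_neg_iff_add_eq_0)
qed

text \<open>If a central \<open>w\<close> were outside \<open>D\<close>, a hyperplane complementary to \<open>w\<close> could be chosen to
  contain \<open>D\<close>. It would contain all brackets, hence be a subalgebra, and the line of \<open>w\<close> would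
  split off; as \<open>D\<close> is not zero, neither summand would be zero.\<close>

lemma central_in_derived:
  assumes indec: "\<not> decomposable"
    and D: "subspace D" "D \<noteq> {0}" "\<And>x y. bracket x y \<in> D"
    and central: "\<And>x. bracket x w = 0"
  shows "w \<in> D"
proof (rule ccontr)
  assume w: "w \<notin> D"
  obtain B where B: "B \<subseteq> D" "independent B" "D \<subseteq> span B"
    using maximal_independent_subset[of D] by blast
  have "w \<notin> span B"
    using w B(1) D(1) span_minimal by blast
  then have "independent (insert w B)"
    using B(2) by (simp add: independent_insertI)
  \<comment> \<open>The basis \<open>C\<close> contains both \<open>w\<close> and a basis of \<open>D\<close>, so dropping \<open>w\<close> keeps \<open>D\<close> in the span.\<close>
  then obtain C where C: "insert w B \<subseteq> C" "independent C" "UNIV \<subseteq> span C"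
    using maximal_independent_subset_extend[of "insert w B" UNIV] by auto
  define H where "H = span (C - {w})"
  have wH: "w \<notin> H"
    using C(1,2) unfolding H_def dependent_def by blast
  have DH: "D \<subseteq> H"
  proof -
    have "w \<notin> B" using w B(1) by blast
    then have "span B \<subseteq> H"
      unfolding H_def using C(1) by (intro span_mono) blast
    then show ?thesis using B(3) by blast
  qed
  have "lie_subalgebra H"
    using D(3) DH by (auto simp: lie_subalgebra_def H_def)
  moreover have "lie_subalgebra (span {w})"
    unfolding lie_subalgebra_def using central subspace_0[OF subspace_span[of "{w}"]]
    by (intro conjI ballI subspace_span) (auto simp: span_singleton bracket_scale_right)
  moreover have "H \<noteq> {0}"
    using DH D(1,2) subspace_0 by blast
  moreover have "span {w} \<noteq> {0}"
    using w D(1) span_base[of w "{w}"] subspace_0 by auto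
  moreover have "commuting H (span {w})"
    using central by (auto simp: commuting_def span_singleton bracket_scale_right)
  moreover have "is_direct_sum H (span {w})"
    unfolding is_direct_sum_def
  proof
    have "k = 0" if "scale k w \<in> H" for k
    proof (rule ccontr)
      assume "k \<noteq> 0"
      moreover have "scale (1 / k) (scale k w) \<in> H"
        using that unfolding H_def by (rule span_scale)
      ultimately show False using wH by simp
    qed
    then show "H \<inter> span {w} = {0}"
      by (auto simp: span_singleton H_def span_zero)
    show "{a + b |a b. a \<in> H \<and> b \<in> span {w}} = UNIV"
    proof (rule UNIV_eq_I[symmetric], rule CollectI)
      fix x
      have "x \<in> span (insert w (C - {w}))"
        using C(1,3) by (simp add: insert_absorb subset_iff)
      then obtain k where "x - scale k w \<in> H"
        unfolding H_def span_breakdown_eq by blast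
      then show "\<exists>a b. x = a + b \<and> a \<in> H \<and> b \<in> span {w}"
        by (intro exI[of _ "x - scale k w"] exI[of _ "scale k w"]) (auto simp: span_singleton)
    qed
  qed
  ultimately show False
    using indec unfolding decomposable_def by blast
qed

end

section \<open>The linear form with kernel V\<close>

locale semidirect_lie_algebra = lie_algebra scale bracket
  for scale :: "'a::field \<Rightarrow> 'b::ab_group_add \<Rightarrow> 'b" and bracket +
  fixes V :: "'b set" and e0 :: 'b
  assumes decomp: "semidirect_decomp V e0"
begin

lemma subspace_V: "subspace V"
  and e0_notin: "e0 \<notin> V"
  and ideal_V: "v \<in> V \<Longrightarrow> bracket x v \<in> V"
  and abelian_V: "u \<in> V \<Longrightarrow> v \<in> V \<Longrightarrow> bracket u v = 0"
  using decomp
  by (auto simp: semidirect_decomp_def lie_ideal_def abelian_def commuting_def)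

definition coef :: "'b \<Rightarrow> 'a" where
  "coef x = (THE t. x - scale t e0 \<in> V)"

lemma scale_e0_in_V: "scale t e0 \<in> V \<longleftrightarrow> t = 0"
proof
  assume "scale t e0 \<in> V"
  then have "scale (1 / t) (scale t e0) \<in> V"
    by (rule subspace_scale[OF subspace_V])
  then show "t = 0" using e0_notin by (cases "t = 0") auto
qed (simp add: subspace_0[OF subspace_V])

lemma coef_eqI:
  assumes "x - scale t e0 \<in> V"
  shows "coef x = t"
  unfolding coef_def
proof (rule the_equality[where P = "\<lambda>t. x - scale t e0 \<in> V", OF assms])
  fix s assume "x - scale s e0 \<in> V"
  from subspace_diff[OF subspace_V assms this] have "scale (s - t) e0 \<in> V"
    by (simp add: scale_left_diff_distrib)
  then show "s = t" by (simp add: scale_e0_in_V)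
qed

lemma minus_coef_in_V: "x - scale (coef x) e0 \<in> V"
proof -
  have "x \<in> {a + b | a b. a \<in> V \<and> b \<in> span {e0}}"
    using decomp by (auto simp: semidirect_decomp_def is_direct_sum_def)
  then obtain v t where "v \<in> V" "x = v + scale t e0"
    by (auto simp: span_singleton)
  then have "x - scale t e0 \<in> V" by simp
  then show ?thesis using coef_eqI by metis
qed

lemma coef_V [simp]: "v \<in> V \<Longrightarrow> coef v = 0"
  by (rule coef_eqI) simp

lemma coef_zero_iff: "coef x = 0 \<longleftrightarrow> x \<in> V"
  using minus_coef_in_V[of x] by auto

lemma coef_e0 [simp]: "coef e0 = 1"
  by (rule coef_eqI) (simp add: subspace_0[OF subspace_V])

lemma coef_add [simp]: "coef (x + y) = coef x + coef y"
  using subspace_add[OF subspace_V minus_coef_in_V[of x] minus_coef_in_V[of y]]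
  by (intro coef_eqI) (simp add: algebra_simps scale_left_distrib)

lemma coef_scale [simp]: "coef (scale c x) = c * coef x"
  using subspace_scale[OF subspace_V minus_coef_in_V[of x], of c]
  by (intro coef_eqI) (simp add: scale_right_diff_distrib)

lemma bracket_e0_minus: "bracket e0 (x - scale t e0) = bracket e0 x"
  by (simp add: bracket_diff_right bracket_scale_right bracket_self)

text \<open>The components in \<open>V\<close> commute, which leaves brackets with \<open>e0\<close>. These do not see multiples
  of \<open>e0\<close>, so \<open>x\<close> and \<open>y\<close> may stand in for their components in \<open>V\<close>.\<close>

lemma bracket_eq: "bracket x y = scale (coef x) (bracket e0 y) - scale (coef y) (bracket e0 x)"
proof -
  define u v where "u = x - scale (coef x) e0" and "v = y - scale (coef y) e0"
  have xy: "x = u + scale (coef x) e0" "y = v + scale (coef y) e0"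
    by (simp_all add: u_def v_def)
  have uv: "bracket u v = 0"
    by (simp add: u_def v_def abelian_V minus_coef_in_V)
  have "bracket x y = scale (coef x) (bracket e0 v) + scale (coef y) (bracket u e0)"
    by (subst xy(1), subst xy(2))
      (simp add: bracket_add_left bracket_add_right bracket_scale_left bracket_scale_right
        bracket_self uv)
  also have "bracket u e0 = - bracket e0 u"
    by (rule bracket_anticomm)
  finally show ?thesis
    by (simp add: u_def v_def bracket_e0_minus)
qed

lemma ad_nonzero:
  assumes "\<not> abelian UNIV"
  obtains v where "v \<in> V" "bracket e0 v \<noteq> 0"
proof -
  obtain x y where "bracket x y \<noteq> 0"
    using assms by (auto simp: abelian_def commuting_def)
  then obtain z where "bracket e0 z \<noteq> 0"
    using bracket_eq[of x y] by force
  then have "bracket e0 (z - scale (coef z) e0) \<noteq> 0"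
    by (simp add: bracket_e0_minus)
  then show thesis using that minus_coef_in_V by blast
qed

section \<open>Rank one\<close>

text \<open>The line spanned by \<open>y\<close> is the derived algebra. If \<open>l y \<noteq> 0\<close>, it is complementary to
  the kernel of \<open>l\<close> in \<open>V\<close>; if \<open>l y = 0\<close>, it lies inside this kernel, and a further vector \<open>u\<close>
  with \<open>l u = 1\<close> survives. Indecomposability removes everything else.\<close>

lemma ad_rank_one_cases:
  assumes indec: "\<not> decomposable" and nonab: "\<not> abelian UNIV"
    and l_add: "\<And>x z. l (x + z) = l x + l z" and l_scale: "\<And>c x. l (scale c x) = c * l x"
    and ad: "\<And>v. v \<in> V \<Longrightarrow> bracket e0 v = scale (l v) y"
  shows "lie_isomorphic scale bracket axb_scale axb_bracket \<or>
         lie_isomorphic scale bracket heis_scale heis_bracket"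
proof -
  obtain u0 where u0: "u0 \<in> V" "bracket e0 u0 \<noteq> 0"
    using ad_nonzero[OF nonab] .
  then have y0: "y \<noteq> 0" and l0: "l u0 \<noteq> 0"
    by (auto simp: ad)
  define u where "u = scale (1 / l u0) u0"
  have u: "u \<in> V" "l u = 1"
    using l0 u0(1) by (simp_all add: u_def l_scale subspace_scale[OF subspace_V])
  have e0u: "bracket e0 u = y"
    by (simp add: ad u)
  then have yV: "y \<in> V"
    using ideal_V[OF u(1), of e0] by simp
  have l_diff: "l (x - z) = l x - l z" for x z
    using l_add[of "x - z" z] by simp
  have e0_span: "bracket e0 x \<in> span {y}" for x
    using ad[OF minus_coef_in_V[of x]] by (auto simp: bracket_e0_minus span_singleton)
  have derived: "bracket x z \<in> span {y}" for x z
    by (subst bracket_eq) (intro span_diff span_scale e0_span)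
  have ker: "\<exists>b. v = scale b y" if v: "v \<in> V" "l v = 0" for v
  proof -
    \<comment> \<open>\<open>v\<close> is central, since \<open>ad e0\<close> and \<open>V\<close> both annihilate it.\<close>
    have "bracket x v = 0" for x
      using v by (subst bracket_eq) (simp add: ad)
    moreover have "span {y} \<noteq> {0}"
      using y0 span_base[of y "{y}"] by auto
    ultimately have "v \<in> span {y}"
      using central_in_derived[OF indec, of "span {y}" v] derived by simp
    then show ?thesis by (auto simp: span_singleton)
  qed
  show ?thesis
  proof (cases "l y = 0")
    case False
    \<comment> \<open>Dividing \<open>e0\<close> by \<open>l y\<close> makes it act on \<open>y\<close> as the identity.\<close>
    define g where "g = (\<lambda>(a, b). scale (a / l y) e0 + scale b y)"
    have lin: "Vector_Spaces.linear axb_scale scale g"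
      using lie_algebra_axb vector_space_axioms
      by (auto simp: Vector_Spaces.linear_iff lie_algebra_def g_def axb_scale_def
          scale_left_distrib scale_right_distrib add_divide_distrib algebra_simps)
    have coef_g: "coef (g (a, b)) = a / l y" for a b
      by (simp add: g_def yV)
    have "inj g"
    proof (rule injI, unfold split_paired_all)
      fix a b a' b' assume eq: "g (a, b) = g (a', b')"
      then have "a = a'" using coef_g[of a b] coef_g[of a' b'] False by simp
      with eq y0 show "(a, b) = (a', b')" by (simp add: g_def)
    qed
    moreover have "x \<in> range g" for x
    proof -
      define v where "v = x - scale (coef x) e0"
      define b where "b = l v / l y"
      have v: "v \<in> V" by (simp add: v_def minus_coef_in_V)
      have "v - scale b y \<in> V"
        by (intro subspace_diff subspace_scale subspace_V v yV)
      moreover have kl: "l (v - scale b y) = 0"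
        using False by (simp add: l_diff l_scale b_def)
      ultimately obtain c where c: "v - scale b y = scale c y"
        using ker by blast
      then have "c = 0"
        using kl False by (simp add: l_scale)
      then have "v = scale b y"
        using c by simp
      then have "x = g (coef x * l y, b)"
        using False by (simp add: g_def v_def algebra_simps)
      then show ?thesis by blast
    qed
    ultimately have "bij g"
      by (auto simp: bij_def)
    moreover have "g (axb_bracket x z) = bracket (g x) (g z)" for x z
    proof -
      obtain a b a' b' where xz: "x = (a, b)" "z = (a', b')"
        by (cases x, cases z) blast
      have "bracket e0 (g (c, d)) = scale (d * l y) y" for c d
        by (simp add: g_def bracket_add_right bracket_scale_right bracket_self ad yV)
      then show ?thesis
        unfolding xz using False
        by (subst bracket_eq)
          (simp add: coef_g, simp add: axb_bracket_def g_def scale_left_diff_distrib algebra_simps)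
    qed
    ultimately show ?thesis
      using lie_isomorphic_if_from_model[OF lin] by blast
  next
    case True
    \<comment> \<open>Here \<open>[e0, u] = y\<close> and \<open>[e0, y] = 0\<close>, so \<open>y\<close> is the central basis vector.\<close>
    define g where "g = (\<lambda>(a, b, c). scale a e0 + scale b y + scale c u)"
    have lin: "Vector_Spaces.linear heis_scale scale g"
      using lie_algebra_heis vector_space_axioms
      by (auto simp: Vector_Spaces.linear_iff lie_algebra_def g_def heis_scale_def
          scale_left_distrib scale_right_distrib algebra_simps)
    have coef_g: "coef (g (a, b, c)) = a" for a b c
      by (simp add: g_def yV u)
    have e0_g: "bracket e0 (g (a, b, c)) = scale c y" for a b c
      by (simp add: g_def bracket_add_right bracket_scale_right bracket_self e0u
          ad[OF yV] True)
    have "inj g"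
    proof (rule injI, unfold split_paired_all)
      fix a b c a' b' c' assume eq: "g (a, b, c) = g (a', b', c')"
      have "a = a'" using coef_g[of a b c] coef_g[of a' b' c'] eq by simp
      moreover have "c = c'" using e0_g[of a b c] e0_g[of a' b' c'] eq y0 by simp
      ultimately show "(a, b, c) = (a', b', c')"
        using eq y0 by (simp add: g_def)
    qed
    moreover have "x \<in> range g" for x
    proof -
      define v where "v = x - scale (coef x) e0"
      have v: "v \<in> V" by (simp add: v_def minus_coef_in_V)
      have "v - scale (l v) u \<in> V"
        by (intro subspace_diff subspace_scale subspace_V v u)
      moreover have "l (v - scale (l v) u) = 0"
        by (simp add: l_diff l_scale u)
      ultimately obtain b where b: "v - scale (l v) u = scale b y"
        using ker by blast
      have "x = scale (coef x) e0 + (v - scale (l v) u) + scale (l v) u"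
        by (simp add: v_def)
      then have "x = g (coef x, b, l v)"
        by (simp add: g_def b)
      then show ?thesis by blast
    qed
    ultimately have "bij g"
      by (auto simp: bij_def)
    moreover have "g (heis_bracket x z) = bracket (g x) (g z)" for x z
    proof -
      obtain a b c a' b' c' where xz: "x = (a, b, c)" "z = (a', b', c')"
        by (cases x, cases z) blast
      show ?thesis
        unfolding xz
        by (subst bracket_eq)
          (simp add: coef_g e0_g, simp add: heis_bracket_def g_def scale_left_diff_distrib algebra_simps)
    qed
    ultimately show ?thesis
      using lie_isomorphic_if_from_model[OF lin] by blast
  qed
qed

section \<open>Lie orthogonal operators\<close>

text \<open>For \<open>v\<close> in \<open>V\<close>, \<open>[T u, T v] = [u, v] = 0\<close> forces \<open>[e0, T v]\<close> to be proportional to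
  \<open>[e0, T u]\<close> with factor \<open>coef (T v) / coef (T u)\<close>. Both terms of \<open>[T e0, T v]\<close> are then
  \<open>coef (T v)\<close> times a vector independent of \<open>v\<close>.\<close>

lemma ad_rank_one_if_not_preserving:
  assumes T: "T \<in> LO" and u: "u \<in> V" "T u \<notin> V"
  obtains y where "\<And>v. v \<in> V \<Longrightarrow> bracket e0 v = scale (coef (T v)) y"
proof -
  have br: "bracket (T x) (T z) = bracket x z" for x z
    using T by (simp add: LO_def)
  define y where "y = scale (coef (T e0)) (scale (1 / coef (T u)) (bracket e0 (T u))) - bracket e0 (T e0)"
  have cu: "coef (T u) \<noteq> 0"
    using u(2) by (simp add: coef_zero_iff)
  have "bracket e0 v = scale (coef (T v)) y" if v: "v \<in> V" for v
  proof -
    have "scale (coef (T u)) (bracket e0 (T v)) = scale (coef (T v)) (bracket e0 (T u))"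
      using br[of u v] v u(1) bracket_eq[of "T u" "T v"] by (simp add: abelian_V)
    then have "scale (1 / coef (T u)) (scale (coef (T u)) (bracket e0 (T v))) =
        scale (1 / coef (T u)) (scale (coef (T v)) (bracket e0 (T u)))"
      by simp
    then have Tv: "bracket e0 (T v) = scale (coef (T v)) (scale (1 / coef (T u)) (bracket e0 (T u)))"
      using cu by (simp add: mult.commute)
    have "bracket e0 v = scale (coef (T e0)) (bracket e0 (T v)) - scale (coef (T v)) (bracket e0 (T e0))"
      using br[of e0 v] bracket_eq[of "T e0" "T v"] by simp
    then show ?thesis
      by (simp add: y_def Tv scale_right_diff_distrib mult.commute mult.left_commute)
  qed
  then show thesis by (rule that)
qed

lemma block_op_eq:
  "block_op V e0 D g a x = D (x - scale (coef x) e0) + scale (coef x) g + scale (a * coef x) e0"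
  using block_op_apply[OF decomp minus_coef_in_V[of x], of D g a "coef x"] by simp

text \<open>\<open>Z\<close> disappears under \<open>ad e0\<close>, the two factors \<open>a\<close> and \<open>1 / a\<close> cancel, and the
  contribution of \<open>g\<close> is symmetric in the two arguments, hence drops out of the bracket.\<close>

lemma block_op_in_LO:
  assumes a: "a \<noteq> 0" and g: "g \<in> V" and Z: "Z \<in> Hom V (ker_ad V e0)"
  shows "block_op V e0 (\<lambda>v. scale (1 / a) v + Z v) g a \<in> LO" (is "?T \<in> LO")
proof -
  let ?v = "\<lambda>x. x - scale (coef x) e0"
  have Z_add: "Z (v + w) = Z v + Z w" if "v \<in> V" "w \<in> V" for v w
    using Z that by (auto simp: Hom_def)
  have Z_scale: "Z (scale c v) = scale c (Z v)" if "v \<in> V" for c v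
    using Z that by (auto simp: Hom_def)
  have Z_V: "Z v \<in> V" and Z_ker: "bracket e0 (Z v) = 0" if "v \<in> V" for v
    using Z that by (auto simp: Hom_def ker_ad_def Pi_iff)
  have T: "?T x = scale (1 / a) (?v x) + Z (?v x) + scale (coef x) g + scale (a * coef x) e0" for x
    by (simp add: block_op_eq)
  have v_add: "?v (x + z) = ?v x + ?v z" for x z
    by (simp add: scale_left_distrib)
  have v_scale: "?v (scale c x) = scale c (?v x)" for c x
    by (simp add: scale_right_diff_distrib)
  have Z_v_add: "Z (?v (x + z)) = Z (?v x) + Z (?v z)" for x z
    unfolding v_add by (intro Z_add minus_coef_in_V)
  have Z_v_scale: "Z (?v (scale c x)) = scale c (Z (?v x))" for c x
    unfolding v_scale by (rule Z_scale[OF minus_coef_in_V])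
  have "?T (x + z) = ?T x + ?T z" for x z
    unfolding T Z_v_add unfolding v_add
    by (simp only: coef_add scale_right_distrib scale_left_distrib distrib_left) (simp only: ac_simps)
  moreover have "?T (scale c x) = scale c (?T x)" for c x
    unfolding T Z_v_scale unfolding v_scale
    by (simp only: coef_scale scale_right_distrib scale_scale mult.left_commute mult.commute)
  ultimately have "Vector_Spaces.linear scale scale ?T"
    using vector_space_axioms by (simp add: Vector_Spaces.linear_iff)
  moreover have "bracket (?T x) (?T z) = bracket x z" for x z
  proof -
    have coef_T: "coef (?T x) = a * coef x" for x
      unfolding T using minus_coef_in_V[of x] Z_V[of "?v x"] g by simp
    have e0_T: "bracket e0 (?T x) = scale (1 / a) (bracket e0 x) + scale (coef x) (bracket e0 g)"
      for x
      unfolding T using Z_ker[of "?v x"] minus_coef_in_V[of x]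
      by (simp add: bracket_add_right bracket_scale_right bracket_self bracket_e0_minus)
    have "bracket (?T x) (?T z) =
        scale (a * coef x) (scale (1 / a) (bracket e0 z) + scale (coef z) (bracket e0 g)) -
        scale (a * coef z) (scale (1 / a) (bracket e0 x) + scale (coef x) (bracket e0 g))"
      by (subst bracket_eq) (simp only: coef_T e0_T)
    also have "\<dots> = scale (coef x) (bracket e0 z) - scale (coef z) (bracket e0 x)"
      using a by (simp add: scale_right_distrib mult.commute mult.left_commute)
    finally show ?thesis by (simp add: bracket_eq[of x z])
  qed
  ultimately show ?thesis by (simp add: LO_def)
qed

text \<open>On \<open>V\<close> the condition reads \<open>a [e0, T v] = [e0, v]\<close> with \<open>a = coef (T e0)\<close>. As \<open>ad e0\<close> does
  not vanish, \<open>a\<close> is not zero, and \<open>Z = T - 1 / a\<close> is annihilated by \<open>ad e0\<close>.\<close>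

lemma LO_preserving_block_op:
  assumes nonab: "\<not> abelian UNIV" and T: "T \<in> LO" and pres: "\<And>v. v \<in> V \<Longrightarrow> T v \<in> V"
  shows "\<exists>a g Z. T = block_op V e0 (\<lambda>v. scale (1 / a) v + Z v) g a \<and>
           a \<noteq> 0 \<and> g \<in> V \<and> Z \<in> Hom V (ker_ad V e0)"
proof -
  define a where "a = coef (T e0)"
  define g where "g = T e0 - scale a e0"
  define Z where "Z = (\<lambda>v. T v - scale (1 / a) v)"
  have T_add: "T (x + z) = T x + T z" and T_scale: "T (scale c x) = scale c (T x)"
    and br: "bracket (T x) (T z) = bracket x z" for x z c
    using T by (simp_all add: LO_def Vector_Spaces.linear_iff)
  have ad: "scale a (bracket e0 (T v)) = bracket e0 v" if "v \<in> V" for v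
    using br[of e0 v] bracket_eq[of "T e0" "T v"] pres[OF that] by (simp add: a_def)
  obtain u where "u \<in> V" "bracket e0 u \<noteq> 0"
    using ad_nonzero[OF nonab] .
  with ad[of u] have a: "a \<noteq> 0" by auto
  have "bracket e0 (Z v) = 0" if "v \<in> V" for v
  proof -
    have "bracket e0 (Z v) = bracket e0 (T v) - scale (1 / a) (scale a (bracket e0 (T v)))"
      by (simp only: Z_def bracket_diff_right bracket_scale_right ad[OF that])
    also have "\<dots> = 0" using a by simp
    finally show ?thesis .
  qed
  moreover have "Z v \<in> V" if "v \<in> V" for v
    unfolding Z_def by (intro subspace_diff subspace_scale subspace_V pres that)
  ultimately have "Z \<in> Hom V (ker_ad V e0)"
    by (auto simp: Hom_def ker_ad_def)
      (simp_all add: Z_def T_add T_scale scale_right_distrib scale_right_diff_distrib mult.commute)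
  moreover have "g \<in> V"
    unfolding g_def a_def by (rule minus_coef_in_V)
  moreover have "T = block_op V e0 (\<lambda>v. scale (1 / a) v + Z v) g a"
  proof
    fix x
    have "T x = T ((x - scale (coef x) e0) + scale (coef x) e0)"
      by simp
    also have "\<dots> = T (x - scale (coef x) e0) + scale (coef x) (T e0)"
      by (simp only: T_add T_scale)
    also have "\<dots> = block_op V e0 (\<lambda>v. scale (1 / a) v + Z v) g a x"
      by (simp add: block_op_eq Z_def g_def scale_right_diff_distrib mult.commute)
    finally show "T x = block_op V e0 (\<lambda>v. scale (1 / a) v + Z v) g a x" .
  qed
  ultimately show ?thesis using a by blast
qed

end

theorem proposition15:
  fixes scale :: "'a::field \<Rightarrow> 'b::ab_group_add \<Rightarrow> 'b"
    and bracket :: "'b \<Rightarrow> 'b \<Rightarrow> 'b"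
    and V :: "'b set" and e0 :: 'b
  assumes "lie_algebra scale bracket"
    and "lie_algebra.almost_abelian scale bracket"
    and "lie_algebra.semidirect_decomp scale bracket V e0"
    and "\<not> lie_algebra.decomposable scale bracket"
    and "\<not> lie_isomorphic scale bracket axb_scale axb_bracket"
    and "\<not> lie_isomorphic scale bracket heis_scale heis_bracket"
  shows "lie_algebra.LO scale bracket =
    {lie_algebra.block_op scale V e0 (\<lambda>v. scale (1 / \<alpha>) v + Z v) \<gamma> \<alpha> | \<alpha> \<gamma> Z.
       \<alpha> \<noteq> 0 \<and> \<gamma> \<in> V \<and> Z \<in> lie_algebra.Hom scale V (lie_algebra.ker_ad bracket V e0)}"
proof -
  interpret lie_algebra scale bracket by fact
  interpret semidirect_lie_algebra scale bracket V e0
    using assms(3) by unfold_locales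
  have nonab: "\<not> abelian UNIV"
    using assms(2) by (simp add: almost_abelian_def)
  have pres: "T v \<in> V" if T: "T \<in> LO" and v: "v \<in> V" for T v
  proof (rule ccontr)
    assume "T v \<notin> V"
    then obtain y where y: "\<And>w. w \<in> V \<Longrightarrow> bracket e0 w = scale (coef (T w)) y"
      using ad_rank_one_if_not_preserving[OF T v] by blast
    have "coef (T (x + z)) = coef (T x) + coef (T z)" "coef (T (scale c x)) = c * coef (T x)" for x z c
      using T by (simp_all add: LO_def Vector_Spaces.linear_iff)
    from ad_rank_one_cases[where l = "\<lambda>w. coef (T w)", OF assms(4) nonab this y]
    show False using assms(5,6) by blast
  qed
  show ?thesis
    using LO_preserving_block_op[OF nonab] block_op_in_LO pres by blast
qed

end
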